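(* Consider the bimodal Kuramoto model with confidence bound $\Delta\in[0,\pi]$ and natural frequencies $\pm\omega_0$, $\omega_0\ge0$. Any linearly stable fixed-point solution for a cluster of $2n$ oscillators with all-to-all interactions is necessarily in the 2-group configuration: there exist phases $\theta_+,\theta_-\in\mathbb S^1$ such that every oscillator of the cluster belonging to $\bm I_+$ has phase $\theta_+$ and every oscillator of the cluster belonging to $\bm I_-$ has phase $\theta_-$.
   Context: Model: $N$ (even) oscillators with phases $\theta_i\in\mathbb S^1$ evolve by $\dot\theta_i=\omega_i-\frac1N\sum_{j=1}^N a_{ij}\sin(\theta_i-\theta_j)$, where $a_{ij}=1$ if $\|\theta_i-\theta_j\|\le\Delta$ and $0$ otherwise, $\|\cdot\|$ being geodesic distance on $\mathbb S^1$. The index set is partitioned into $\bm I_+$ and $\bm I_-$ of equal cardinality, with $\omega_i=\omega_0$ for $i\in\bm I_+$ and $\omega_i=-\omega_0$ for $i\in\bm I_-$. A fixed point has $\dot\theta_i=0$ for all $i$. A cluster is a connected component of the graph with adjacency matrix $(a_{ij})$ at the fixed point; a cluster of $2n$ oscillators has $n$ oscillators from each of $\bm I_+$ and $\bm I_-$. Since oscillators in different clusters do not interact, the phases of a cluster $\Lambda$ at a fixed point satisfy $\omega_i=\frac1N\sum_{j\in\Lambda}a_{ij}\sin(\theta_i-\theta_j)$ for all $i\in\Lambda$. The cluster has all-to-all interactions if $a_{ij}=1$ for all $i,j\in\Lambda$. The stability matrix of the cluster is the $2n\times2n$ matrix $\mathcal J_{ij}=a_{ij}\cos(\theta_i-\theta_j)$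 for $i\ne j$, $\mathcal J_{ii}=-\sum_{k\in\Lambda,k\ne i}a_{ik}\cos(\theta_i-\theta_k)$. It has eigenvalue $0$ with eigenvector $(1,\dots,1)$. The fixed point of the cluster is linearly stable if all the other $2n-1$ eigenvalues (with multiplicity) are strictly negative. *)

theory Defs
  imports Complex_Main "HOL-Library.Real_Mod" "Jordan_Normal_Form.Char_Poly"
begin

text \<open>
  A point of the circle is given by a real representative of its angle, so that two phases are
  equal on the circle iff their representatives are congruent modulo \<open>2 * pi\<close>. Everything defined
  below depends only on the points of the circle, not on the representatives chosen.
  The oscillators are indexed by \<open>{..<N}\<close>.
\<close>

definition circle_dist :: "real \<Rightarrow> real \<Rightarrow> real" where
  "circle_dist x y = (INF k::int. \<bar>x - y + 2 * pi * of_int k\<bar>)"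

definition adj :: "real \<Rightarrow> (nat \<Rightarrow> real) \<Rightarrow> nat \<Rightarrow> nat \<Rightarrow> real" where
  "adj \<Delta> \<theta> i j = (if circle_dist (\<theta> i) (\<theta> j) \<le> \<Delta> then 1 else 0)"

text \<open>The velocity of oscillator \<open>i\<close>, i.e. the right-hand side of the equations of motion.\<close>

definition velocity ::
    "nat \<Rightarrow> real \<Rightarrow> (nat \<Rightarrow> real) \<Rightarrow> (nat \<Rightarrow> real) \<Rightarrow> nat \<Rightarrow> real" where
  "velocity N \<Delta> \<omega> \<theta> i =
     \<omega> i - 1 / of_nat N * (\<Sum>j<N. adj \<Delta> \<theta> i j * sin (\<theta> i - \<theta> j))"

definition fixed_point :: "nat \<Rightarrow> real \<Rightarrow> (nat \<Rightarrow> real) \<Rightarrow> (nat \<Rightarrow> real) \<Rightarrow> bool" where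
  "fixed_point N \<Delta> \<omega> \<theta> \<longleftrightarrow> (\<forall>i<N. velocity N \<Delta> \<omega> \<theta> i = 0)"

definition edges :: "nat \<Rightarrow> real \<Rightarrow> (nat \<Rightarrow> real) \<Rightarrow> (nat \<times> nat) set" where
  "edges N \<Delta> \<theta> = {(i, j). i < N \<and> j < N \<and> adj \<Delta> \<theta> i j = 1}"

text \<open>The edge relation is symmetric, so these equivalence classes are the connected components.\<close>

definition cluster :: "nat \<Rightarrow> real \<Rightarrow> (nat \<Rightarrow> real) \<Rightarrow> nat set \<Rightarrow> bool" where
  "cluster N \<Delta> \<theta> \<Lambda> \<longleftrightarrow> \<Lambda> \<in> {..<N} // (edges N \<Delta> \<theta>)\<^sup>*"

definition all_to_all :: "real \<Rightarrow> (nat \<Rightarrow> real) \<Rightarrow> nat set \<Rightarrow> bool" where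
  "all_to_all \<Delta> \<theta> \<Lambda> \<longleftrightarrow> (\<forall>i\<in>\<Lambda>. \<forall>j\<in>\<Lambda>. adj \<Delta> \<theta> i j = 1)"

definition stability_entry ::
    "real \<Rightarrow> (nat \<Rightarrow> real) \<Rightarrow> nat set \<Rightarrow> nat \<Rightarrow> nat \<Rightarrow> real" where
  "stability_entry \<Delta> \<theta> \<Lambda> i j =
     (if i \<noteq> j then adj \<Delta> \<theta> i j * cos (\<theta> i - \<theta> j)
      else - (\<Sum>k\<in>\<Lambda> - {i}. adj \<Delta> \<theta> i k * cos (\<theta> i - \<theta> k)))"

text \<open>
  The rows and columns of the stability matrix are indexed by the elements of \<open>\<Lambda>\<close> in increasing
  order; another order would give a similar matrix.
\<close>

definition stability_matrix :: "real \<Rightarrow> (nat \<Rightarrow> real) \<Rightarrow> nat set \<Rightarrow> real mat" where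
  "stability_matrix \<Delta> \<theta> \<Lambda> =
     mat (card \<Lambda>) (card \<Lambda>) (\<lambda>(r, s).
       stability_entry \<Delta> \<theta> \<Lambda> (sorted_list_of_set \<Lambda> ! r) (sorted_list_of_set \<Lambda> ! s))"

text \<open>
  The list of eigenvalues with multiplicity is \<open>0 # es\<close>. The stability matrix is real symmetric,
  so its characteristic polynomial does split over the reals.
\<close>

definition linearly_stable :: "real \<Rightarrow> (nat \<Rightarrow> real) \<Rightarrow> nat set \<Rightarrow> bool" where
  "linearly_stable \<Delta> \<theta> \<Lambda> \<longleftrightarrow>
     (\<exists>es. length es = card \<Lambda> - 1 \<and>
           char_poly (stability_matrix \<Delta> \<theta> \<Lambda>) = (\<Prod>e\<leftarrow>0 # es. [:- e, 1:]) \<and>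
           (\<forall>e\<in>set es. e < 0))"

end

theory Submission
  imports Defs "Jordan_Normal_Form.Spectral_Radius"
begin

text \<open>
  Let \<open>Z = C + \<i>S\<close> be the sum of the unit vectors \<open>exp (\<i>\<theta>\<^sub>j)\<close> over the cluster, and let \<open>B\<^sub>i\<close> and \<open>A\<^sub>i\<close>
  be the components of \<open>Z\<close> along \<open>exp (\<i>\<theta>\<^sub>i)\<close> and, up to sign, orthogonal to it. The fixed point
  equations say \<open>A\<^sub>i = N\<omega>\<^sub>i\<close>, so oscillators of equal frequency share \<open>A\<^sub>i\<close>, and hence
  \<open>B\<^sub>i\<^sup>2 = |Z|\<^sup>2 - A\<^sub>i\<^sup>2\<close>. A symmetric matrix without positive eigenvalues has no positive diagonal
  entry, and the diagonal entries of the stability matrix are \<open>1 - B\<^sub>i\<close>; so \<open>B\<^sub>i \<ge> 1\<close>, which fixes the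
  sign of \<open>B\<^sub>i\<close>. Then \<open>Z \<noteq> 0\<close>, and \<open>A\<^sub>i\<close> and \<open>B\<^sub>i\<close> determine the phase.
\<close>

section \<open>Powers and diagonal entries of symmetric matrices\<close>

lemma pow_mat_add:
  assumes A: "(A :: 'a :: semiring_1 mat) \<in> carrier_mat n n"
  shows "A ^\<^sub>m (k + l) = A ^\<^sub>m k * A ^\<^sub>m l"
proof -
  interpret R: semiring "ring_mat TYPE('a) n ()" by (rule semiring_mat)
  have "A \<in> carrier (ring_mat TYPE('a) n ())" using A by (simp add: ring_mat_simps)
  from R.nat_pow_mult[OF this, of k l] show ?thesis
    by (simp add: pow_mat_ring_pow[OF A, where b = "()"] ring_mat_simps)
qed

lemma transpose_pow_mat_symmetric:
  assumes A: "(A :: 'a :: comm_semiring_1 mat) \<in> carrier_mat n n" and sym: "transpose_mat A = A"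
  shows "transpose_mat (A ^\<^sub>m k) = A ^\<^sub>m k"
proof (induction k)
  case (Suc k)
  have "transpose_mat (A ^\<^sub>m Suc k) = A * A ^\<^sub>m k"
    using transpose_mult[of "A ^\<^sub>m k" n n A n] Suc A sym by simp
  also have "\<dots> = A ^\<^sub>m Suc k"
    using pow_mat_add[OF A, of 1 k] A by simp
  finally show ?case .
qed (use A in simp)

text \<open>By symmetry the diagonal entry of the square is the sum of the squares along row
  \<open>i\<close>, and the squared diagonal entry is one of its terms.\<close>

lemma symmetric_square_diag_ge:
  assumes A: "(A :: real mat) \<in> carrier_mat n n" and sym: "transpose_mat A = A" and i: "i < n"
  shows "(A $$ (i, i))\<^sup>2 \<le> (A * A) $$ (i, i)"
proof -
  have "A $$ (j, i) = A $$ (i, j)" if "j < n" for j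
    using that i A sym index_transpose_mat(1)[of i A j] by auto
  then have "(A * A) $$ (i, i) = (\<Sum>j<n. (A $$ (i, j))\<^sup>2)"
    using A i by (auto simp: scalar_prod_def power2_eq_square lessThan_atLeast0 intro!: sum.cong)
  moreover have "(A $$ (i, i))\<^sup>2 \<le> (\<Sum>j<n. (A $$ (i, j))\<^sup>2)"
    using i by (intro member_le_sum) auto
  ultimately show ?thesis by simp
qed

text \<open>Repeated squaring: the bound for squares applies again to each power, which is still
  symmetric. Hence the exponents \<open>2 ^ m\<close>.\<close>

lemma symmetric_pow_diag_ge:
  assumes A: "(A :: real mat) \<in> carrier_mat n n" and sym: "transpose_mat A = A" and i: "i < n"
    and pos: "0 \<le> A $$ (i, i)"
  shows "(A $$ (i, i)) ^ (2 ^ m) \<le> (A ^\<^sub>m (2 ^ m)) $$ (i, i)"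
proof (induction m)
  case 0
  then show ?case using A by simp
next
  case (Suc m)
  have C: "A ^\<^sub>m (2 ^ m) \<in> carrier_mat n n" using A by simp
  have "(A $$ (i, i)) ^ (2 ^ Suc m) = ((A $$ (i, i)) ^ (2 ^ m))\<^sup>2"
    by (simp add: power_mult[symmetric] mult.commute)
  also have "\<dots> \<le> ((A ^\<^sub>m (2 ^ m)) $$ (i, i))\<^sup>2"
    using Suc pos by (intro power_mono) auto
  also have "\<dots> \<le> (A ^\<^sub>m (2 ^ m) * A ^\<^sub>m (2 ^ m)) $$ (i, i)"
    by (rule symmetric_square_diag_ge[OF C transpose_pow_mat_symmetric[OF A sym] i])
  also have "A ^\<^sub>m (2 ^ m) * A ^\<^sub>m (2 ^ m) = A ^\<^sub>m (2 ^ Suc m)"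
    by (simp add: pow_mat_add[OF A, symmetric] mult_2)
  finally show ?case .
qed

text \<open>Spectral radius below 1 keeps the entries of all powers bounded, while a diagonal entry
  above 1 would make those of the powers \<open>2 ^ m\<close> grow beyond any bound.\<close>

lemma symmetric_diag_le_1:
  assumes A: "(A :: real mat) \<in> carrier_mat n n" and sym: "transpose_mat A = A" and i: "i < n"
    and sr: "spectral_radius (map_mat of_real A) < 1"
  shows "A $$ (i, i) \<le> 1"
proof (rule ccontr)
  assume "\<not> A $$ (i, i) \<le> 1"
  then have gt: "1 < A $$ (i, i)" by simp
  let ?C = "map_mat of_real A :: complex mat"
  have "?C \<in> carrier_mat n n" using A by simp
  from spectral_radius_jnf_norm_bound_less_1_upper_triangular[OF this sr]
  obtain b where b: "norm_bound (?C ^\<^sub>m k) b" for k by blast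
  have bound: "(A ^\<^sub>m k) $$ (i, i) \<le> b" for k
  proof -
    have "?C ^\<^sub>m k = map_mat of_real (A ^\<^sub>m k)"
      by (rule of_real_hom.mat_hom_pow[OF A, symmetric])
    with b[of k] A i have "norm (complex_of_real ((A ^\<^sub>m k) $$ (i, i))) \<le> b"
      unfolding norm_bound_def by (auto simp del: norm_of_real)
    then show ?thesis by simp
  qed
  obtain m where m: "b < (A $$ (i, i)) ^ m" using real_arch_pow[OF gt] by blast
  have "(A $$ (i, i)) ^ m \<le> (A $$ (i, i)) ^ (2 ^ m)"
    using gt by (intro power_increasing) (auto intro: less_imp_le[OF less_exp])
  also have "\<dots> \<le> (A ^\<^sub>m (2 ^ m)) $$ (i, i)"
    using symmetric_pow_diag_ge[OF A sym i] gt by simp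
  also have "\<dots> \<le> b" by (rule bound)
  finally show False using m by simp
qed

text \<open>
  If a diagonal entry \<open>a\<close> were positive, then \<open>A + c I\<close> would, for \<open>c\<close> bounding the moduli of the
  eigenvalues, have spectral radius at most \<open>c\<close> but the diagonal entry \<open>a + c > c\<close>; rescaling by
  \<open>1 / (c + a / 2)\<close> separates these two numbers by \<open>1\<close>.
\<close>

lemma symmetric_nonpos_eigenvalues_diag_le_0:
  assumes A: "(A :: real mat) \<in> carrier_mat n n" and sym: "transpose_mat A = A" and i: "i < n"
    and cp: "char_poly A = (\<Prod>e\<leftarrow>es. [:- e, 1:])" and nonpos: "\<forall>e\<in>set es. e \<le> 0"
  shows "A $$ (i, i) \<le> 0"
proof (rule ccontr)
  define a where "a = A $$ (i, i)"
  assume "\<not> A $$ (i, i) \<le> 0"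
  then have a: "0 < a" by (simp add: a_def)
  define c where "c = (\<Sum>e\<leftarrow>es. \<bar>e\<bar>)"
  have c: "\<bar>e\<bar> \<le> c" if "e \<in> set es" for e
    unfolding c_def using that by (intro member_le_sum_list) auto
  have c0: "0 \<le> c" unfolding c_def by (intro sum_list_nonneg) auto
  define k where "k = 1 / (c + a / 2)"
  have k: "0 < k" using a c0 by (simp add: k_def)
  define B where "B = k \<cdot>\<^sub>m (A + c \<cdot>\<^sub>m 1\<^sub>m n)"
  have B: "B \<in> carrier_mat n n" using A by (simp add: B_def)
  have symB: "transpose_mat B = B"
  proof (rule eq_matI)
    fix p q assume pq: "p < dim_row B" "q < dim_col B"
    then have "A $$ (q, p) = A $$ (p, q)"
      using A B sym index_transpose_mat(1)[of p A q] by auto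
    with pq A B show "transpose_mat B $$ (p, q) = B $$ (p, q)"
      by (auto simp: B_def)
  qed (use B in auto)
  let ?A = "map_mat complex_of_real A" and ?B = "map_mat complex_of_real B"
  have cA: "?A \<in> carrier_mat n n" and cB: "?B \<in> carrier_mat n n" using A B by auto
  have small: "norm E < 1" if ev: "eigenvalue ?B E" for E
  proof -
    from ev cB obtain v where v: "v \<in> carrier_vec n" "v \<noteq> 0\<^sub>v n" "?B *\<^sub>v v = E \<cdot>\<^sub>v v"
      unfolding eigenvalue_def eigenvector_def by auto
    \<comment> \<open>Solving \<open>B = k (A + c I)\<close> for \<open>A\<close> turns the
      eigenvalue \<open>E\<close> of \<open>B\<close> into \<open>E / k - c\<close> with the same
      eigenvector; this is checked entrywise.\<close>
    have "?A *\<^sub>v v = (E / of_real k - of_real c) \<cdot>\<^sub>v v"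
    proof (rule eq_vecI)
      fix p assume "p < dim_vec ((E / of_real k - of_real c) \<cdot>\<^sub>v v)"
      with v have p: "p < n" by simp
      have "E * v $ p = (?B *\<^sub>v v) $ p" using v p by simp
      also have "\<dots> = (\<Sum>q<n. of_real (B $$ (p, q)) * v $ q)"
        using v(1) p B by (simp add: scalar_prod_def lessThan_atLeast0)
      also have "\<dots> = (\<Sum>q<n. of_real k * (of_real (A $$ (p, q)) * v $ q +
          (if q = p then of_real c * v $ q else 0)))"
        using A p by (intro sum.cong) (auto simp: B_def algebra_simps)
      also have "\<dots> = of_real k * ((\<Sum>q<n. of_real (A $$ (p, q)) * v $ q) + of_real c * v $ p)"
        using p by (simp add: sum_distrib_left[symmetric] sum.distrib)
      also have "(\<Sum>q<n. of_real (A $$ (p, q)) * v $ q) = (?A *\<^sub>v v) $ p"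
        using v(1) p A by (simp add: scalar_prod_def lessThan_atLeast0)
      finally have "E * v $ p = of_real k * ((?A *\<^sub>v v) $ p + of_real c * v $ p)" .
      then show "(?A *\<^sub>v v) $ p = ((E / of_real k - of_real c) \<cdot>\<^sub>v v) $ p"
        using k p v(1) by (simp add: field_simps)
    qed (use v(1) A in auto)
    then have "eigenvalue ?A (E / of_real k - of_real c)"
      using v cA unfolding eigenvalue_def eigenvector_def by auto
    then have "poly (char_poly ?A) (E / of_real k - of_real c) = 0"
      using eigenvalue_root_char_poly[OF cA] by simp
    \<comment> \<open>The real factorization carries over to the complex numbers, so every complex
      eigenvalue of \<open>A\<close> is one of the real numbers \<open>es\<close>.\<close>
    moreover have "char_poly ?A = (\<Prod>e\<leftarrow>map of_real es. [:- e, 1:])"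
    proof -
      interpret h: map_poly_comm_ring_hom complex_of_real ..
      show ?thesis
        unfolding of_real_hom.char_poly_hom[OF A] cp by (simp add: h.hom_prod_list o_def)
    qed
    ultimately obtain e where e: "e \<in> set es" "E / of_real k - of_real c = of_real e"
      using linear_poly_root
      by (auto simp: poly_prod_list prod_list_zero_iff)
    then have "E = of_real (k * (c + e))" using k by (simp add: field_simps)
    then have "norm E = k * \<bar>c + e\<bar>" using k by (simp only: norm_of_real abs_mult abs_of_pos)
    \<comment> \<open>Here the sign of the eigenvalues enters: \<open>- c \<le> e \<le> 0\<close>
      gives \<open>0 \<le> c + e \<le> c\<close>.\<close>
    also have "\<dots> \<le> k * c" using c[OF e(1)] nonpos e(1) k by (intro mult_left_mono) auto
    also have "\<dots> < 1" using a c0 by (simp add: k_def field_simps)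
    finally show ?thesis .
  qed
  have "spectral_radius ?B \<in> norm ` spectrum ?B"
    by (rule spectral_radius_mem_max(1)[OF cB]) (use i in simp)
  then have "spectral_radius ?B < 1" using small by (auto simp: spectrum_def)
  from symmetric_diag_le_1[OF B symB i this] have "k * (a + c) \<le> 1"
    using A i by (simp add: B_def a_def)
  then show False using a c0 by (simp add: k_def field_simps)
qed

section \<open>The stability matrix of an all-to-all cluster\<close>

lemma stable_diag_entry_nonpos:
  assumes fin: "finite \<Lambda>" and all: "all_to_all \<Delta> \<theta> \<Lambda>" and st: "linearly_stable \<Delta> \<theta> \<Lambda>"
    and i: "i \<in> \<Lambda>"
  shows "stability_entry \<Delta> \<theta> \<Lambda> i i \<le> 0"
proof -
  let ?l = "sorted_list_of_set \<Lambda>" and ?J = "stability_matrix \<Delta> \<theta> \<Lambda>"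
  have l: "set ?l = \<Lambda>" "length ?l = card \<Lambda>" using fin by simp_all
  have J: "?J \<in> carrier_mat (card \<Lambda>) (card \<Lambda>)" by (simp add: stability_matrix_def)
  have sym: "transpose_mat ?J = ?J"
  proof (rule eq_matI)
    fix r s assume "r < dim_row ?J" "s < dim_col ?J"
    then have rs: "r < card \<Lambda>" "s < card \<Lambda>" by (simp_all add: stability_matrix_def)
    with l have "?l ! r \<in> \<Lambda>" "?l ! s \<in> \<Lambda>" by (metis nth_mem)+
    \<comment> \<open>All adjacencies are 1 and the cosine is even.\<close>
    with all have "stability_entry \<Delta> \<theta> \<Lambda> (?l ! s) (?l ! r) = stability_entry \<Delta> \<theta> \<Lambda> (?l ! r) (?l ! s)"
      by (auto simp: stability_entry_def all_to_all_def cos_diff algebra_simps)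
    with rs show "transpose_mat ?J $$ (r, s) = ?J $$ (r, s)"
      by (simp add: stability_matrix_def)
  qed (simp_all add: stability_matrix_def)
  from i l obtain r where r: "r < card \<Lambda>" "?l ! r = i" by (metis in_set_conv_nth)
  from st obtain es where "char_poly ?J = (\<Prod>e\<leftarrow>0 # es. [:- e, 1:])" "\<forall>e\<in>set es. e < 0"
    unfolding linearly_stable_def by blast
  then have "?J $$ (r, r) \<le> 0"
    by (intro symmetric_nonpos_eigenvalues_diag_le_0[OF J sym r(1), of "0 # es"]) auto
  then show ?thesis using r by (simp add: stability_matrix_def)
qed

section \<open>Restriction of the fixed point equations to one cluster\<close>

lemma cluster_subset: "cluster N \<Delta> \<theta> \<Lambda> \<Longrightarrow> \<Lambda> \<subseteq> {..<N}"
  unfolding cluster_def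
  by (auto elim!: quotientE rtranclE simp: edges_def)

lemma cluster_closed:
  assumes "cluster N \<Delta> \<theta> \<Lambda>" "i \<in> \<Lambda>" "j < N" "adj \<Delta> \<theta> i j = 1"
  shows "j \<in> \<Lambda>"
proof -
  have "(i, j) \<in> edges N \<Delta> \<theta>"
    using assms cluster_subset[OF assms(1)] by (auto simp: edges_def)
  then show ?thesis using assms(1,2) unfolding cluster_def
    by (auto elim!: quotientE intro: rtrancl_into_rtrancl)
qed

text \<open>Oscillators outside the cluster are not adjacent to \<open>i\<close>, and those inside
  all have weight 1.\<close>

lemma fixed_point_cluster:
  assumes fp: "fixed_point N \<Delta> \<omega> \<theta>" and cl: "cluster N \<Delta> \<theta> \<Lambda>" and all: "all_to_all \<Delta> \<theta> \<Lambda>"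
    and i: "i \<in> \<Lambda>"
  shows "(\<Sum>j\<in>\<Lambda>. sin (\<theta> i - \<theta> j)) = N * \<omega> i"
proof -
  from cluster_subset[OF cl] i have iN: "i < N" by auto
  have "(\<Sum>j\<in>\<Lambda>. sin (\<theta> i - \<theta> j)) = (\<Sum>j\<in>\<Lambda>. adj \<Delta> \<theta> i j * sin (\<theta> i - \<theta> j))"
    using all i by (auto simp: all_to_all_def intro!: sum.cong)
  also have "\<dots> = (\<Sum>j<N. adj \<Delta> \<theta> i j * sin (\<theta> i - \<theta> j))"
  proof (rule sum.mono_neutral_left)
    have "adj \<Delta> \<theta> i j = 0" if "j < N" "j \<notin> \<Lambda>" for j
      using cluster_closed[OF cl i that(1)] that(2) by (auto simp: adj_def split: if_splits)
    then show "\<forall>j\<in>{..<N} - \<Lambda>. adj \<Delta> \<theta> i j * sin (\<theta> i - \<theta> j) = 0" by simp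
  qed (use cluster_subset[OF cl] in auto)
  also have "\<dots> = N * \<omega> i"
    using fp iN by (auto simp: fixed_point_def velocity_def field_simps)
  finally show ?thesis .
qed

section \<open>From the cosine sums to equal phases\<close>

lemma stable_cos_sum_ge_1:
  assumes fin: "finite \<Lambda>" and all: "all_to_all \<Delta> \<theta> \<Lambda>" and st: "linearly_stable \<Delta> \<theta> \<Lambda>"
    and i: "i \<in> \<Lambda>"
  shows "1 \<le> (\<Sum>j\<in>\<Lambda>. cos (\<theta> i - \<theta> j))"
proof -
  have "(\<Sum>j\<in>\<Lambda> - {i}. adj \<Delta> \<theta> i j * cos (\<theta> i - \<theta> j)) = (\<Sum>j\<in>\<Lambda> - {i}. cos (\<theta> i - \<theta> j))"
    using all i by (auto simp: all_to_all_def intro!: sum.cong)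
  \<comment> \<open>The term \<open>j = i\<close> is \<open>cos 0 = 1\<close>, so the diagonal entry
    is 1 minus the full sum.\<close>
  with stable_diag_entry_nonpos[OF assms] sum.remove[OF fin i, of "\<lambda>j. cos (\<theta> i - \<theta> j)"]
  show ?thesis by (simp add: stability_entry_def)
qed

lemma same_frequency_same_phase:
  assumes fp: "fixed_point N \<Delta> \<omega> \<theta>" and cl: "cluster N \<Delta> \<theta> \<Lambda>"
    and all: "all_to_all \<Delta> \<theta> \<Lambda>" and st: "linearly_stable \<Delta> \<theta> \<Lambda>"
    and ij: "i \<in> \<Lambda>" "j \<in> \<Lambda>" and eq: "\<omega> i = \<omega> j"
  shows "[\<theta> i = \<theta> j] (rmod (2 * pi))"
proof -
  have fin: "finite \<Lambda>" using cluster_subset[OF cl] finite_subset by blast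
  define C S where "C = (\<Sum>k\<in>\<Lambda>. cos (\<theta> k))" and "S = (\<Sum>k\<in>\<Lambda>. sin (\<theta> k))"
  \<comment> \<open>With \<open>Z = C + iS\<close>, \<open>B x + i A x\<close> is
    \<open>exp (ix)\<close> times the conjugate of \<open>Z\<close>; \<open>AB\<close> below
    compares squared moduli.\<close>
  define A B where "A x = sin x * C - cos x * S" and "B x = cos x * C + sin x * S" for x
  have A: "A (\<theta> k) = N * \<omega> k" if "k \<in> \<Lambda>" for k
    using fixed_point_cluster[OF fp cl all that]
    by (simp add: A_def C_def S_def sin_diff sum_subtractf sum_distrib_left)
  have B: "1 \<le> B (\<theta> k)" if "k \<in> \<Lambda>" for k
    using stable_cos_sum_ge_1[OF fin all st that]
    by (simp add: B_def C_def S_def cos_diff sum.distrib sum_distrib_left)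
  have AB: "(A x)\<^sup>2 + (B x)\<^sup>2 = C\<^sup>2 + S\<^sup>2" for x
  proof -
    have "(s * C - c * S)\<^sup>2 + (c * C + s * S)\<^sup>2 = (s\<^sup>2 + c\<^sup>2) * (C\<^sup>2 + S\<^sup>2)" for s c :: real
      by (simp add: power2_eq_square algebra_simps)
    from this[of "sin x" "cos x"] show ?thesis by (simp add: A_def B_def)
  qed
  have Aeq: "A (\<theta> i) = A (\<theta> j)" using A ij eq by simp
  with AB[of "\<theta> i"] AB[of "\<theta> j"] have "(B (\<theta> i))\<^sup>2 = (B (\<theta> j))\<^sup>2" by simp
  \<comment> \<open>Both values are at least 1, which excludes opposite signs.\<close>
  then have Beq: "B (\<theta> i) = B (\<theta> j)" using B[OF ij(1)] B[OF ij(2)] by (simp add: power2_eq_iff)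
  have R: "C\<^sup>2 + S\<^sup>2 \<noteq> 0"
    using AB[of "\<theta> i"] B[OF ij(1)] zero_le_power2[of "A (\<theta> i)"] by (smt (verit) zero_less_power)
  \<comment> \<open>Multiplying \<open>B x + i A x\<close> by \<open>Z\<close> recovers
    \<open>exp (ix)\<close> times the squared modulus of \<open>Z\<close>, so \<open>A x\<close> and
    \<open>B x\<close> determine the phase.\<close>
  have "sin x * (C\<^sup>2 + S\<^sup>2) = A x * C + B x * S" "cos x * (C\<^sup>2 + S\<^sup>2) = B x * C - A x * S" for x
    unfolding A_def B_def by (simp_all add: power2_eq_square algebra_simps)
  with Aeq Beq R have "sin (\<theta> j) = sin (\<theta> i)" "cos (\<theta> j) = cos (\<theta> i)"
    by (metis mult_right_cancel)+
  then obtain m :: int where "\<theta> j = \<theta> i + 2 * pi * m" using sin_cos_eq_iff by blast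
  then show ?thesis unfolding rcong_altdef by (intro exI[of _ m]) simp
qed

theorem mainTheorem3:
  fixes N n :: nat and \<Delta> \<omega>\<^sub>0 :: real
    and Iplus Iminus \<Lambda> :: "nat set" and \<omega> \<theta> :: "nat \<Rightarrow> real"
  assumes "even N"
    and "Iplus \<union> Iminus = {..<N}" and "Iplus \<inter> Iminus = {}" and "card Iplus = card Iminus"
    and "0 \<le> \<Delta>" and "\<Delta> \<le> pi" and "0 \<le> \<omega>\<^sub>0"
    and "\<And>i. i \<in> Iplus \<Longrightarrow> \<omega> i = \<omega>\<^sub>0"
    and "\<And>i. i \<in> Iminus \<Longrightarrow> \<omega> i = - \<omega>\<^sub>0"
    and "fixed_point N \<Delta> \<omega> \<theta>"
    and "cluster N \<Delta> \<theta> \<Lambda>"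
    and "card \<Lambda> = 2 * n" and "card (\<Lambda> \<inter> Iplus) = n" and "card (\<Lambda> \<inter> Iminus) = n"
    and "all_to_all \<Delta> \<theta> \<Lambda>"
    and "linearly_stable \<Delta> \<theta> \<Lambda>"
  shows "\<exists>\<theta>p \<theta>m :: real.
           (\<forall>i \<in> \<Lambda> \<inter> Iplus. [\<theta> i = \<theta>p] (rmod (2 * pi))) \<and>
           (\<forall>i \<in> \<Lambda> \<inter> Iminus. [\<theta> i = \<theta>m] (rmod (2 * pi)))"
proof -
  \<comment> \<open>The phase of any one member serves as the common phase; if the intersection is
    empty, any number does.\<close>
  have phase: "\<exists>\<phi>. \<forall>i\<in>\<Lambda> \<inter> I. [\<theta> i = \<phi>] (rmod (2 * pi))"
    if freq: "\<And>i. i \<in> I \<Longrightarrow> \<omega> i = w" for I :: "nat set" and w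
  proof (cases "\<Lambda> \<inter> I = {}")
    case False
    then obtain j where j: "j \<in> \<Lambda>" "j \<in> I" by blast
    have "[\<theta> i = \<theta> j] (rmod (2 * pi))" if "i \<in> \<Lambda> \<inter> I" for i
      using same_frequency_same_phase[of N \<Delta> \<omega> \<theta> \<Lambda> i j] assms(10,11,15,16) j that freq by simp
    then show ?thesis by blast
  qed simp
  show ?thesis using phase[of Iplus \<omega>\<^sub>0] phase[of Iminus "- \<omega>\<^sub>0"] assms(8,9) by blast
qed

end
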